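(* Let $P=(v_2,v_6,v_1,v_3,v_5)^\top=(v_2,v_6,0,0,0)^\top$ with $v_2\ge v_6\ge 1$. Then $P$ is PNS-free. Moreover, if one parameterizes $v_6=b$ and $v_2=(\theta+3b-1)(\theta^2+(3b-2)\theta-3b+4)$ with $\theta\in\mathbb{R}$, then the critical value at $P$ is $$M=(\theta+3b-1)^2\,(3\theta^2+(10b-6)\theta+3b^2-10b+9)$$ and the critical minimizer is $\bar{\mathbf{x}}=(1,0,-(\theta+3b-1),0)^\top$.
   Context: A fourth order four dimensional Hankel tensor $\mathcal{A}=(a_{i_1i_2i_3i_4})$ with generating vector $\mathbf{v}=(v_0,\ldots,v_{12})^\top\in\mathbb{R}^{13}$ is defined by $a_{i_1i_2i_3i_4}=v_{i_1+i_2+i_3+i_4-4}$ for $i_1,i_2,i_3,i_4\in\{1,2,3,4\}$. Its associated polynomial is $f(\mathbf{x})=\sum_{i_1,i_2,i_3,i_4=1}^4 v_{i_1+i_2+i_3+i_4-4}\,x_{i_1}x_{i_2}x_{i_3}x_{i_4}$, $\mathbf{x}\in\mathbb{R}^4$. $\mathcal{A}$ is PSD if $f(\mathbf{x})\ge 0$ for all $\mathbf{x}\in\mathbb{R}^4$; it is SOS if $f$ is a sum of squares of real quadratic homogeneous polynomials. Given $P=(v_2,v_6,v_1,v_3,v_5)^\top\in\mathbb{R}^5$ and $v_0\in\mathbb{R}$, $\mathcal{A}$ denotes the Hankel tensor with generating vector $(v_0,v_1,v_2,v_3,1,v_5,v_6,v_5,1,v_3,v_2,v_1,v_0)^\top$.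 $M_0(P)$ (respectively $N_0(P)$) denotes the smallest $v_0$ for which $\mathcal{A}$ is SOS (respectively PSD), so that $\mathcal{A}$ is SOS iff $v_0\ge M_0(P)$ and PSD iff $v_0\ge N_0(P)$. $P$ is called PNS-free if $M_0(P)$ and $N_0(P)$ exist and $M_0(P)=N_0(P)$. A number $M$ is the critical value, and a point $\bar{\mathbf{x}}\in\mathbb{R}^4$ with $\bar x_1^2+\bar x_4^2>0$ is a critical minimizer, of $\mathcal{A}$ at $P$ if for $v_0=M$ the tensor $\mathcal{A}$ is SOS and its polynomial $f_0$ satisfies $f_0(\bar{\mathbf{x}})=0$. *)

theory Defs
  imports "HOL-Analysis.Analysis"
begin

text \<open>Tensors are indexed by natural numbers; only indices in \<open>{1..4}\<close> matter.\<close>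

type_synonym tensor4 = "nat \<Rightarrow> nat \<Rightarrow> nat \<Rightarrow> nat \<Rightarrow> real"

definition hankel_tensor :: "(nat \<Rightarrow> real) \<Rightarrow> tensor4" where
  "hankel_tensor v = (\<lambda>i1 i2 i3 i4. v (i1 + i2 + i3 + i4 - 4))"

text \<open>The coercion \<open>of_nat\<close> maps \<open>{1..4}\<close> bijectively onto the index type \<open>4\<close>
  (where \<open>4 = 0\<close>).\<close>

definition tensor_poly :: "tensor4 \<Rightarrow> real^4 \<Rightarrow> real" where
  "tensor_poly A x =
     (\<Sum>i1\<in>{1..4}. \<Sum>i2\<in>{1..4}. \<Sum>i3\<in>{1..4}. \<Sum>i4\<in>{1..4}.
        A i1 i2 i3 i4 * x $ of_nat i1 * x $ of_nat i2 * x $ of_nat i3 * x $ of_nat i4)"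

definition psd_tensor :: "tensor4 \<Rightarrow> bool" where
  "psd_tensor A \<longleftrightarrow> (\<forall>x. tensor_poly A x \<ge> 0)"

text \<open>Polynomials are identified with polynomial functions, which loses nothing over the reals.\<close>

definition homogeneous_quadratic :: "(real^4 \<Rightarrow> real) \<Rightarrow> bool" where
  "homogeneous_quadratic q \<longleftrightarrow>
     (\<exists>B :: real^4^4. \<forall>x. q x = (\<Sum>i\<in>UNIV. \<Sum>j\<in>UNIV. B $ i $ j * x $ i * x $ j))"

definition sos_tensor :: "tensor4 \<Rightarrow> bool" where
  "sos_tensor A \<longleftrightarrow>
     (\<exists>(n::nat) (q :: nat \<Rightarrow> real^4 \<Rightarrow> real).
        (\<forall>k<n. homogeneous_quadratic (q k)) \<and>
        (\<forall>x. tensor_poly A x = (\<Sum>k<n. (q k x)\<^sup>2)))"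

text \<open>A point \<open>P\<close> is the tuple \<open>(v2, v6, v1, v3, v5)\<close>, in this order.\<close>

type_synonym hankel_point = "real \<times> real \<times> real \<times> real \<times> real"

fun gen_vector :: "hankel_point \<Rightarrow> real \<Rightarrow> nat \<Rightarrow> real" where
  "gen_vector (v2, v6, v1, v3, v5) v0 k =
     [v0, v1, v2, v3, 1, v5, v6, v5, 1, v3, v2, v1, v0] ! k"

definition sym_hankel :: "hankel_point \<Rightarrow> real \<Rightarrow> tensor4" where
  "sym_hankel P v0 = hankel_tensor (gen_vector P v0)"

text \<open>\<open>is_M0 P M\<close> and \<open>is_N0 P N\<close> say that the minimal values \<open>M\<^sub>0(P)\<close> and \<open>N\<^sub>0(P)\<close> exist
  and equal \<open>M\<close> and \<open>N\<close>.\<close>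

definition is_M0 :: "hankel_point \<Rightarrow> real \<Rightarrow> bool" where
  "is_M0 P M \<longleftrightarrow>
     sos_tensor (sym_hankel P M) \<and> (\<forall>v0. sos_tensor (sym_hankel P v0) \<longrightarrow> M \<le> v0)"

definition is_N0 :: "hankel_point \<Rightarrow> real \<Rightarrow> bool" where
  "is_N0 P N \<longleftrightarrow>
     psd_tensor (sym_hankel P N) \<and> (\<forall>v0. psd_tensor (sym_hankel P v0) \<longrightarrow> N \<le> v0)"

definition PNS_free :: "hankel_point \<Rightarrow> bool" where
  "PNS_free P \<longleftrightarrow> (\<exists>M N. is_M0 P M \<and> is_N0 P N \<and> M = N)"

definition critical_value_minimizer :: "hankel_point \<Rightarrow> real \<Rightarrow> real^4 \<Rightarrow> bool" where
  "critical_value_minimizer P M x \<longleftrightarrow>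
     (x $ 1)\<^sup>2 + (x $ 4)\<^sup>2 > 0 \<and>
     sos_tensor (sym_hankel P M) \<and>
     tensor_poly (sym_hankel P M) x = 0"

end

theory Submission
  imports Defs
begin

text \<open>
  For \<open>v\<^sub>1 = v\<^sub>3 = v\<^sub>5 = 0\<close> the polynomial splits as
  \<open>g(x\<^sub>1,x\<^sub>3) + g(x\<^sub>4,x\<^sub>2) + B(x)\<close> with
  \<open>g(p,q) = v\<^sub>0 p\<^sup>4 + 4 v\<^sub>2 p\<^sup>3 q + 6 p\<^sup>2 q\<^sup>2 + 4 v\<^sub>6 p q\<^sup>3 + q\<^sup>4\<close>, where the mixed part \<open>B\<close> does not
  involve \<open>v\<^sub>0\<close> and is visibly a sum of squares when \<open>v\<^sub>2 \<ge> v\<^sub>6 \<ge> 1\<close>.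
  The point \<open>(1,0,-s,0)\<close> is critical for \<open>g\<close> iff \<open>v\<^sub>2 = s\<^sup>3 - 3 v\<^sub>6 s\<^sup>2 + 3 s\<close>; for the value of
  \<open>v\<^sub>0\<close> at which \<open>g\<close> also vanishes there, \<open>g\<close> is \<open>(q + s p)\<^sup>2\<close> times a quadratic form whose
  discriminant has the right sign. Hence the tensor is SOS at that \<open>v\<^sub>0\<close>, and evaluating at the
  zero shows that it is not even PSD for smaller \<open>v\<^sub>0\<close>. The parameter of the theorem is
  \<open>\<theta> = s - 3 b + 1\<close>.
\<close>

lemma homogeneous_quadratic_monomial: "homogeneous_quadratic (\<lambda>x. c * (x $ i * x $ j))"
proof -
  \<comment> \<open>The coefficient matrix is \<open>c\<close> times the matrix unit at
    \<open>(i, j)\<close>.\<close>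
  have "c * (x $ i * x $ j) = (\<Sum>k\<in>UNIV. \<Sum>l\<in>UNIV.
      (\<chi> k l. if k = i then if l = j then c else 0 else 0) $ k $ l * x $ k * x $ l)"
    for x :: "real^4"
    by (simp add: if_distrib [of "\<lambda>y. y * _"] if_distrib [of "\<lambda>y. y $ _"]
        if_distrib [of "\<lambda>y. sum y _"] sum.delta cong: if_cong)
       (simp add: sum.If_cases sum.delta if_distrib [of "\<lambda>y. y * _"] cong: if_cong)
  then show ?thesis
    unfolding homogeneous_quadratic_def by blast
qed

lemma homogeneous_quadratic_add:
  assumes "homogeneous_quadratic p" "homogeneous_quadratic q"
  shows "homogeneous_quadratic (\<lambda>x. p x + q x)"
proof -
  obtain B C :: "real^4^4" where
    "\<forall>x. p x = (\<Sum>i\<in>UNIV. \<Sum>j\<in>UNIV. B $ i $ j * x $ i * x $ j)"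
    "\<forall>x. q x = (\<Sum>i\<in>UNIV. \<Sum>j\<in>UNIV. C $ i $ j * x $ i * x $ j)"
    using assms unfolding homogeneous_quadratic_def by blast
  then have "\<forall>x. p x + q x = (\<Sum>i\<in>UNIV. \<Sum>j\<in>UNIV. (B + C) $ i $ j * x $ i * x $ j)"
    by (simp add: distrib_right sum.distrib)
  then show ?thesis
    unfolding homogeneous_quadratic_def by blast
qed

text \<open>Allows the squares to be given as an explicit list.\<close>

lemma sos_tensorI_list:
  assumes "\<forall>q\<in>set qs. homogeneous_quadratic q"
    and "\<And>x. tensor_poly A x = (\<Sum>q\<leftarrow>qs. (q x)\<^sup>2)"
  shows "sos_tensor A"
  unfolding sos_tensor_def
proof (intro exI conjI)
  show "\<forall>k<length qs. homogeneous_quadratic (qs ! k)"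
    using assms(1) by simp
  show "\<forall>x. tensor_poly A x = (\<Sum>k<length qs. ((qs ! k) x)\<^sup>2)"
    by (simp add: assms(2) sum_list_sum_nth atLeast0LessThan)
qed

lemma sos_imp_psd: "sos_tensor A \<Longrightarrow> psd_tensor A"
  unfolding sos_tensor_def psd_tensor_def by (metis sum_nonneg zero_le_power2)

lemma tensor_poly_sym_hankel:
  "tensor_poly (sym_hankel (a, b, 0, 0, 0) v0) x =
     v0 * x$1 ^ 4 + 4 * a * x$1 ^ 3 * x$3 + 6 * (x$1)\<^sup>2 * (x$3)\<^sup>2 + 4 * b * x$1 * x$3 ^ 3 + x$3 ^ 4
   + (v0 * x$4 ^ 4 + 4 * a * x$4 ^ 3 * x$2 + 6 * (x$4)\<^sup>2 * (x$2)\<^sup>2 + 4 * b * x$4 * x$2 ^ 3 + x$2 ^ 4)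
   + 6 * (b * ((x$1 * x$4 + x$2 * x$3)\<^sup>2 + (x$1 * x$2 + x$3 * x$4)\<^sup>2)
        + 2 * (x$1 * x$4 + x$2 * x$3) * (x$1 * x$2 + x$3 * x$4)
        + (a - b) * ((x$1 * x$2)\<^sup>2 + (x$3 * x$4)\<^sup>2))"
proof -
  have "{1..4::nat} = {1, 2, 3, 4}" by auto
  then show ?thesis
    unfolding tensor_poly_def sym_hankel_def hankel_tensor_def
    by (simp add: nth_Cons' power2_eq_square power3_eq_cube power4_eq_xxxx algebra_simps)
qed

text \<open>The zero \<open>s\<close> lies outside the interval where the cofactor of \<open>(q + s p)\<^sup>2\<close> is indefinite.\<close>

lemma cofactor_discriminant_nonneg:
  fixes a b s :: real
  assumes "a \<ge> b" "b \<ge> 1" and a: "a = s ^ 3 - 3 * b * s\<^sup>2 + 3 * s"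
  shows "s\<^sup>2 - 2 * b * s - 2 * b\<^sup>2 + 3 \<ge> 0"
proof (rule ccontr)
  assume neg: "\<not> ?thesis"
  \<comment> \<open>Centring at \<open>b\<close> depresses the cubic, and the claim becomes
    \<open>z\<^sup>2 \<ge> 3 * r\<^sup>2\<close>.\<close>
  define z where "z = b - s"
  define r where "r = sqrt (b\<^sup>2 - 1)"
  have "b\<^sup>2 \<ge> 1" using assms(2) by simp
  then have r2: "r\<^sup>2 = b\<^sup>2 - 1" and "r \<ge> 0" by (simp_all add: r_def)
  have z2: "z\<^sup>2 < 3 * r\<^sup>2"
    using neg unfolding r2 z_def by (simp add: power2_eq_square algebra_simps)
  then have "r > 0" using \<open>r \<ge> 0\<close> by (cases "r = 0") auto
  have "r\<^sup>2 < b\<^sup>2" by (simp add: r2)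
  then have "r < b" using assms(2) by (simp add: power2_less_imp_less)
  have "z * (3 * r\<^sup>2 - z\<^sup>2) = a - 3 * b + 2 * b ^ 3"
    unfolding r2 z_def a by algebra
  then have ge: "z * (3 * r\<^sup>2 - z\<^sup>2) \<ge> 2 * b * r\<^sup>2"
    using assms(1) unfolding r2 by (simp add: power2_eq_square power3_eq_cube algebra_simps)
  moreover have "2 * b * r\<^sup>2 > 0" using \<open>r > 0\<close> assms(2) by simp
  ultimately have "z > 0"
    using z2 by (smt (verit) mult_nonpos_nonneg)
  \<comment> \<open>For \<open>z > 0\<close> the maximum of
    \<open>z * (3 * r\<^sup>2 - z\<^sup>2)\<close> is \<open>2 * r ^ 3\<close>, attained at
    \<open>z = r\<close>; since \<open>r < b\<close>, this is below the bound in
    \<open>ge\<close>.\<close>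
  have "(r - z)\<^sup>2 * (2 * r + z) \<ge> 0" using \<open>z > 0\<close> \<open>r > 0\<close> by simp
  moreover have "(r - z)\<^sup>2 * (2 * r + z) = 2 * r * r\<^sup>2 - z * (3 * r\<^sup>2 - z\<^sup>2)" by algebra
  moreover have "r * r\<^sup>2 < b * r\<^sup>2" using \<open>r < b\<close> \<open>r > 0\<close> by simp
  ultimately show False using ge by linarith
qed

lemma sos_sym_hankel:
  fixes a b s :: real
  assumes "a \<ge> b" "b \<ge> 1" and a: "a = s ^ 3 - 3 * b * s\<^sup>2 + 3 * s"
  shows "sos_tensor (sym_hankel (a, b, 0, 0, 0) (s\<^sup>2 * (3 * s\<^sup>2 - 8 * b * s + 6)))"
proof -
  define k where "k = sqrt (2 * (s\<^sup>2 - 2 * b * s - 2 * b\<^sup>2 + 3))"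
  define c where "c = sqrt (6 * (b - 1))"
  define d where "d = sqrt (6 * (a - b))"
  define e :: real where "e = sqrt 6"
  have squares: "k\<^sup>2 = 2 * (s\<^sup>2 - 2 * b * s - 2 * b\<^sup>2 + 3)" "c\<^sup>2 = 6 * (b - 1)"
      "d\<^sup>2 = 6 * (a - b)" "e\<^sup>2 = 6"
    using assms(1,2) cofactor_discriminant_nonneg [OF assms]
    by (simp_all add: k_def c_def d_def e_def)
  \<comment> \<open>The cofactor of \<open>(q + s * p)\<^sup>2\<close> is
    \<open>(q + (2 * b - s) * p)\<^sup>2 + k\<^sup>2 * p\<^sup>2\<close>; both products are written
    out as sums of monomials.\<close>
  have factor: "s\<^sup>2 * (3 * s\<^sup>2 - 8 * b * s + 6) * p ^ 4 + 4 * a * p ^ 3 * q + 6 * p\<^sup>2 * q\<^sup>2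
        + 4 * b * p * q ^ 3 + q ^ 4
      = (1 * (q * q) + (2 * b * (p * q) + s * (2 * b - s) * (p * p)))\<^sup>2
        + (k * (p * q) + k * s * (p * p))\<^sup>2" for p q :: real
  proof -
    have "(k * (p * q) + k * s * (p * p))\<^sup>2 = k\<^sup>2 * (p * q + s * (p * p))\<^sup>2" by algebra
    then show ?thesis unfolding squares a by algebra
  qed
  \<comment> \<open>The cross term is absorbed by \<open>(X + Y)\<^sup>2\<close>, which lowers the
    coefficient \<open>b\<close> to \<open>b - 1\<close>.\<close>
  have mixed: "6 * (b * (X\<^sup>2 + Y\<^sup>2) + 2 * X * Y + (a - b) * (u\<^sup>2 + w\<^sup>2))
      = c\<^sup>2 * X\<^sup>2 + c\<^sup>2 * Y\<^sup>2 + e\<^sup>2 * (X + Y)\<^sup>2 + d\<^sup>2 * u\<^sup>2 + d\<^sup>2 * w\<^sup>2" for X Y u w :: real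
    unfolding squares by algebra
  let ?qs = "[\<lambda>x. 1 * (x$3 * x$3) + (2 * b * (x$1 * x$3) + s * (2 * b - s) * (x$1 * x$1)),
    \<lambda>x. k * (x$1 * x$3) + k * s * (x$1 * x$1),
    \<lambda>x. 1 * (x$2 * x$2) + (2 * b * (x$4 * x$2) + s * (2 * b - s) * (x$4 * x$4)),
    \<lambda>x. k * (x$4 * x$2) + k * s * (x$4 * x$4),
    \<lambda>x. c * (x$1 * x$4) + c * (x$2 * x$3),
    \<lambda>x. c * (x$1 * x$2) + c * (x$3 * x$4),
    \<lambda>x. e * (x$1 * x$4) + (e * (x$2 * x$3) + (e * (x$1 * x$2) + e * (x$3 * x$4))),
    \<lambda>x. d * (x$1 * x$2), \<lambda>x. d * (x$3 * x$4)] :: (real^4 \<Rightarrow> real) list"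
  show ?thesis
  proof (rule sos_tensorI_list [of ?qs])
    show "\<forall>q\<in>set ?qs. homogeneous_quadratic q"
      unfolding list.set ball_simps
      by (intro conjI homogeneous_quadratic_add homogeneous_quadratic_monomial TrueI)
    fix x :: "real^4"
    show "tensor_poly (sym_hankel (a, b, 0, 0, 0) (s\<^sup>2 * (3 * s\<^sup>2 - 8 * b * s + 6))) x
        = (\<Sum>q\<leftarrow>?qs. (q x)\<^sup>2)"
      unfolding tensor_poly_sym_hankel factor mixed list.map sum_list.Cons sum_list.Nil
      by algebra
  qed
qed

text \<open>Since \<open>v0\<close> multiplies only the fourth powers of the first and last
  coordinates, the value is affine in \<open>v0\<close> with slope 1. This gives both the zero and
  the lower bound on \<open>v0\<close>.\<close>

lemma tensor_poly_sym_hankel_at: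
  "tensor_poly (sym_hankel (s ^ 3 - 3 * b * s\<^sup>2 + 3 * s, b, 0, 0, 0) v0) (vector [1, 0, - s, 0])
    = v0 - s\<^sup>2 * (3 * s\<^sup>2 - 8 * b * s + 6)"
  unfolding tensor_poly_sym_hankel by (simp add: vector_def) algebra

lemma PNS_free_sym_hankel:
  fixes a b s :: real
  assumes "a \<ge> b" "b \<ge> 1" and a: "a = s ^ 3 - 3 * b * s\<^sup>2 + 3 * s"
  shows "PNS_free (a, b, 0, 0, 0)"
proof -
  let ?M = "s\<^sup>2 * (3 * s\<^sup>2 - 8 * b * s + 6)"
  have sos: "sos_tensor (sym_hankel (a, b, 0, 0, 0) ?M)"
    by (rule sos_sym_hankel [OF assms])
  have "?M \<le> v0" if "psd_tensor (sym_hankel (a, b, 0, 0, 0) v0)" for v0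
    using that tensor_poly_sym_hankel_at [of s b v0] unfolding psd_tensor_def a
    by (metis diff_ge_0_iff_ge)
  with sos have "is_M0 (a, b, 0, 0, 0) ?M" "is_N0 (a, b, 0, 0, 0) ?M"
    unfolding is_M0_def is_N0_def by (auto dest: sos_imp_psd)
  then show ?thesis
    unfolding PNS_free_def by blast
qed

text \<open>Supplies \<open>s\<close> for PNS-freeness, where no parameter is given.\<close>

lemma critical_cubic_has_root:
  fixes a b :: real
  assumes "a \<ge> 0" "b \<ge> 0"
  shows "\<exists>s. a = s ^ 3 - 3 * b * s\<^sup>2 + 3 * s"
proof -
  let ?h = "\<lambda>s::real. s ^ 3 - 3 * b * s\<^sup>2 + 3 * s"
  \<comment> \<open>The right endpoint makes both parts of
    \<open>s\<^sup>2 * (s - 3 * b) + 3 * s\<close> nonnegative, the second at least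
    \<open>a\<close>.\<close>
  have "?h (3 * b + a) = (3 * b + a)\<^sup>2 * a + 9 * b + 3 * a" by algebra
  moreover have "(3 * b + a)\<^sup>2 * a \<ge> 0" using assms by simp
  ultimately have "a \<le> ?h (3 * b + a)" using assms by linarith
  then have "\<exists>s\<ge>0. s \<le> 3 * b + a \<and> ?h s = a"
    using assms by (intro IVT') (auto intro!: continuous_intros)
  then show ?thesis by metis
qed

theorem theorem8:
  fixes v2 v6 :: real
  assumes "v2 \<ge> v6" and "v6 \<ge> 1"
  shows "PNS_free (v2, v6, 0, 0, 0) \<and>
    (\<forall>\<theta> b :: real.
       v6 = b \<and> v2 = (\<theta> + 3*b - 1) * (\<theta>^2 + (3*b - 2)*\<theta> - 3*b + 4) \<longrightarrow>
       critical_value_minimizer (v2, v6, 0, 0, 0)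
         ((\<theta> + 3*b - 1)^2 * (3*\<theta>^2 + (10*b - 6)*\<theta> + 3*b^2 - 10*b + 9))
         (vector [1, 0, - (\<theta> + 3*b - 1), 0]))"
proof (intro conjI allI impI)
  obtain s where "v2 = s ^ 3 - 3 * v6 * s\<^sup>2 + 3 * s"
    using critical_cubic_has_root [of v2 v6] assms by auto
  then show "PNS_free (v2, v6, 0, 0, 0)"
    by (rule PNS_free_sym_hankel [OF assms])
next
  fix \<theta> b :: real
  assume "v6 = b \<and> v2 = (\<theta> + 3*b - 1) * (\<theta>^2 + (3*b - 2)*\<theta> - 3*b + 4)"
  then have v6: "v6 = b"
    and v2_eq: "v2 = (\<theta> + 3*b - 1) * (\<theta>^2 + (3*b - 2)*\<theta> - 3*b + 4)" by blast+
  define s where "s = \<theta> + 3*b - 1"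
  have v2: "v2 = s ^ 3 - 3 * v6 * s\<^sup>2 + 3 * s"
    unfolding v2_eq s_def v6 by algebra
  have M: "(\<theta> + 3*b - 1)^2 * (3*\<theta>^2 + (10*b - 6)*\<theta> + 3*b^2 - 10*b + 9)
      = s\<^sup>2 * (3 * s\<^sup>2 - 8 * v6 * s + 6)"
    unfolding s_def v6 by algebra
  show "critical_value_minimizer (v2, v6, 0, 0, 0)
         ((\<theta> + 3*b - 1)^2 * (3*\<theta>^2 + (10*b - 6)*\<theta> + 3*b^2 - 10*b + 9))
         (vector [1, 0, - (\<theta> + 3*b - 1), 0])"
    unfolding M critical_value_minimizer_def unfolding s_def [symmetric]
  proof (intro conjI)
    show "(vector [1, 0, - s, 0] :: real^4) $ 1 ^ 2 + (vector [1, 0, - s, 0] :: real^4) $ 4 ^ 2 > 0"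
      by (simp add: vector_def add_pos_nonneg)
    show "sos_tensor (sym_hankel (v2, v6, 0, 0, 0) (s\<^sup>2 * (3 * s\<^sup>2 - 8 * v6 * s + 6)))"
      by (rule sos_sym_hankel [OF assms v2])
    show "tensor_poly (sym_hankel (v2, v6, 0, 0, 0) (s\<^sup>2 * (3 * s\<^sup>2 - 8 * v6 * s + 6)))
        (vector [1, 0, - s, 0]) = 0"
      unfolding v2 by (subst tensor_poly_sym_hankel_at) simp
  qed
qed

end
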